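(* Let $(\mathbf{X},\mathbf{T})$ and $(\mathbf{Y},\mathbf{R})$ be nonautonomous dynamical systems, let $\mathbf{g}\in\mathbf{C}(\mathbf{Y},\mathbb{R})$ be equicontinuous and let $Z\subset X_0$. (1) If $\boldsymbol{\pi}=\{\pi_k\}_{k=0}^\infty$ is an equisemiconjugacy from $(\mathbf{X},\mathbf{T})$ to $(\mathbf{Y},\mathbf{R})$, then $$P^{\mathrm{B}}(\mathbf{T},\boldsymbol{\pi}^*\mathbf{g},Z)\ge P^{\mathrm{B}}(\mathbf{R},\mathbf{g},\pi_0(Z)),\qquad P^{\mathrm{P}}(\mathbf{T},\boldsymbol{\pi}^*\mathbf{g},Z)\ge P^{\mathrm{P}}(\mathbf{R},\mathbf{g},\pi_0(Z)).$$ In particular, $h_{\mathrm{top}}^{\mathrm{B}}(\mathbf{T},Z)\ge h_{\mathrm{top}}^{\mathrm{B}}(\mathbf{R},\pi_0(Z))$ and $h_{\mathrm{top}}^{\mathrm{P}}(\mathbf{T},Z)\ge h_{\mathrm{top}}^{\mathrm{P}}(\mathbf{R},\pi_0(Z))$. (2) If $\boldsymbol{\pi}$ is an equiconjugacy from $(\mathbf{X},\mathbf{T})$ to $(\mathbf{Y},\mathbf{R})$, then $$P^{\mathrm{B}}(\mathbf{T},\boldsymbol{\pi}^*\mathbf{g},Z)=P^{\mathrm{B}}(\mathbf{R},\mathbf{g},\pi_0(Z)),\qquad P^{\mathrm{P}}(\mathbf{T},\boldsymbol{\pi}^*\mathbf{g},Z)=P^{\mathrm{P}}(\mathbf{R},\mathbf{g},\pi_0(Z)).$$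 In particular, $h_{\mathrm{top}}^{\mathrm{B}}(\mathbf{T},Z)=h_{\mathrm{top}}^{\mathrm{B}}(\mathbf{R},\pi_0(Z))$ and $h_{\mathrm{top}}^{\mathrm{P}}(\mathbf{T},Z)=h_{\mathrm{top}}^{\mathrm{P}}(\mathbf{R},\pi_0(Z))$.
   Context: A nonautonomous dynamical system (NDS) $(\mathbf{X},\mathbf{T})$ consists of a sequence $\mathbf{X}=\{X_k\}_{k=0}^\infty$ of compact metric spaces $(X_k,d_{X_k})$ and a sequence $\mathbf{T}=\{T_k\}_{k=0}^\infty$ of continuous maps $T_k:X_k\to X_{k+1}$. Put $\mathbf{T}^0=\mathrm{id}_{X_0}$ and $\mathbf{T}^j=T_{j-1}\circ\cdots\circ T_0:X_0\to X_j$. For $n\ge1$ and $x,y\in X_0$ let $d_n^{\mathbf{T}}(x,y)=\max_{0\le j\le n-1}d_{X_j}(\mathbf{T}^jx,\mathbf{T}^jy)$, and for $\varepsilon>0$ let $B_n^{\mathbf{T}}(x,\varepsilon)$, $\overline{B}_n^{\mathbf{T}}(x,\varepsilon)$ be the sets of $y\in X_0$ with $d_n^{\mathbf{T}}(x,y)<\varepsilon$, respectively $\le\varepsilon$. $\mathbf{C}(\mathbf{X},\mathbb{R})=\prod_{k\ge0}C(X_k,\mathbb{R})$ is the set of sequences $\mathbf{f}=\{f_k\}_{k=0}^\infty$ of continuous functions $f_k:X_k\to\mathbb{R}$. $\mathbf{f}$ is equicontinuous if for every $\varepsilon>0$ there is $\delta>0$ such that for all $k\ge0$ and all $x',x''\in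 X_k$ with $d_{X_k}(x',x'')<\delta$ one has $|f_k(x')-f_k(x'')|<\varepsilon$. Put $S_n^{\mathbf{T}}\mathbf{f}=\sum_{j=0}^{n-1}f_j\circ\mathbf{T}^j$; $\mathbf{0}$ is the sequence of zero functions. Semiconjugacies: a semiconjugacy from $(\mathbf{X},\mathbf{T})$ to $(\mathbf{Y},\mathbf{R})$ is a sequence $\boldsymbol{\pi}=\{\pi_k\}_{k=0}^\infty$ of surjective continuous maps $\pi_k:X_k\to Y_k$ with $R_k\circ\pi_k=\pi_{k+1}\circ T_k$ for all $k\ge0$; it is a conjugacy if every $\pi_k$ is a homeomorphism. It is an equisemiconjugacy if it is equicontinuous: for every $\varepsilon>0$ there is $\delta>0$ such that for all $k\ge0$ and $x',x''\in X_k$, $d_{X_k}(x',x'')<\delta$ implies $d_{Y_k}(\pi_kx',\pi_kx'')<\varepsilon$. It is an equiconjugacy if it is a conjugacy and both $\boldsymbol{\pi}$ and $\boldsymbol{\pi}^{-1}=\{\pi_k^{-1}\}_{k=0}^\infty$ are equicontinuous. For $\mathbf{g}\in\mathbf{C}(\mathbf{Y},\mathbb{R})$, $\boldsymbol{\pi}^*\mathbf{g}=\{g_k\circ\pi_k\}_{k=0}^\infty\in\mathbf{C}(\mathbf{X},\mathbb{R})$. Bowen pressure: for $Z\subset X_0$, an $(N,\varepsilon)$-cover of $Z$ is a family $\{B_{n_i}^{\mathbf{T}}(x_i,\varepsilon)\}_i$ with $x_i\in X_0$ and integers $n_i\ge N$ whose union contains $Z$. For $s\in\mathbb{R}$, $N,\varepsilon>0$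 let $\mathscr{R}_{N,\varepsilon}^{s}(\mathbf{T},\mathbf{f},Z)=\inf\sum_i\exp(-n_is+S_{n_i}^{\mathbf{T}}\mathbf{f}(x_i))$ over all countable (finite or infinite) $(N,\varepsilon)$-covers of $Z$; $\mathscr{R}_{\varepsilon}^{s}=\lim_{N\to\infty}\mathscr{R}_{N,\varepsilon}^{s}$; $P^{\mathrm{B}}(\mathbf{T},\mathbf{f},Z,\varepsilon)=\inf\{s:\mathscr{R}_{\varepsilon}^{s}(\mathbf{T},\mathbf{f},Z)=0\}$; $P^{\mathrm{B}}(\mathbf{T},\mathbf{f},Z)=\lim_{\varepsilon\to0}P^{\mathrm{B}}(\mathbf{T},\mathbf{f},Z,\varepsilon)$ (monotone limit). Bowen entropy: $h_{\mathrm{top}}^{\mathrm{B}}(\mathbf{T},Z)=P^{\mathrm{B}}(\mathbf{T},\mathbf{0},Z)$. Packing pressure: an $(N,\varepsilon)$-packing of $Z$ is a family of pairwise disjoint closed Bowen balls $\{\overline{B}_{n_i}^{\mathbf{T}}(x_i,\varepsilon)\}_i$ with $x_i\in Z$ and integers $n_i\ge N$. Let $\mathscr{P}_{N,\varepsilon}^{s}(\mathbf{T},\mathbf{f},Z)=\sup\sum_i\exp(-n_is+S_{n_i}^{\mathbf{T}}\mathbf{f}(x_i))$ over all countable (finite or infinite) $(N,\varepsilon)$-packings of $Z$; $\mathscr{P}_{\infty,\varepsilon}^{s}=\lim_{N\to\infty}\mathscr{P}_{N,\varepsilon}^{s}$; $\mathscr{P}_{\varepsilon}^{s}(\mathbf{T},\mathbf{f},Z)=\inf\{\sum_{i=1}^\infty\mathscr{P}_{\infty,\varepsilon}^{s}(\mathbf{T},\mathbf{f},Z_i):\bigcup_iZ_i\supseteq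 Z\}$; $P^{\mathrm{P}}(\mathbf{T},\mathbf{f},Z,\varepsilon)=\inf\{s:\mathscr{P}_{\varepsilon}^{s}(\mathbf{T},\mathbf{f},Z)=0\}$; $P^{\mathrm{P}}(\mathbf{T},\mathbf{f},Z)=\lim_{\varepsilon\to0}P^{\mathrm{P}}(\mathbf{T},\mathbf{f},Z,\varepsilon)$ (monotone limit). Packing entropy: $h_{\mathrm{top}}^{\mathrm{P}}(\mathbf{T},Z)=P^{\mathrm{P}}(\mathbf{T},\mathbf{0},Z)$. The same definitions apply to $(\mathbf{Y},\mathbf{R})$ with metrics $d_{Y_k}$. *)

theory Defs
  imports "HOL-Analysis.Analysis"
begin

section \<open>Nonautonomous dynamical systems\<close>

text \<open>
  The spaces of a sequence \<open>X\<close> are bundled metric spaces with carriers in one type, since HOL types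
  cannot depend on the index. This loses no generality: an arbitrary sequence of sets embeds into
  one set (their disjoint union), and the carriers need not be equal or nested. Values of maps
  outside the carriers are never used.
\<close>

definition nds :: "(nat \<Rightarrow> 'a metric) \<Rightarrow> (nat \<Rightarrow> 'a \<Rightarrow> 'a) \<Rightarrow> bool" where
  "nds X T \<longleftrightarrow>
     (\<forall>k. compact_space (mtopology_of (X k))) \<and>
     (\<forall>k. continuous_map (mtopology_of (X k)) (mtopology_of (X (Suc k))) (T k))"

primrec orbit_map :: "(nat \<Rightarrow> 'a \<Rightarrow> 'a) \<Rightarrow> nat \<Rightarrow> 'a \<Rightarrow> 'a" where
  "orbit_map T 0 = id"
| "orbit_map T (Suc j) = T j \<circ> orbit_map T j"

text \<open>
  The Bowen metrics and balls are meant for \<open>n \<ge> 1\<close>; the value at \<open>n = 0\<close> (which by truncated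
  subtraction is that at \<open>n = 1\<close>) does not affect the limits over \<open>N\<close> below.
\<close>

definition bowen_dist ::
    "(nat \<Rightarrow> 'a metric) \<Rightarrow> (nat \<Rightarrow> 'a \<Rightarrow> 'a) \<Rightarrow> nat \<Rightarrow> 'a \<Rightarrow> 'a \<Rightarrow> real" where
  "bowen_dist X T n x y =
     Max ((\<lambda>j. mdist (X j) (orbit_map T j x) (orbit_map T j y)) ` {0..n - 1})"

definition bowen_ball ::
    "(nat \<Rightarrow> 'a metric) \<Rightarrow> (nat \<Rightarrow> 'a \<Rightarrow> 'a) \<Rightarrow> nat \<Rightarrow> 'a \<Rightarrow> real \<Rightarrow> 'a set" where
  "bowen_ball X T n x \<epsilon> = {y \<in> mspace (X 0). bowen_dist X T n x y < \<epsilon>}"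

definition bowen_cball ::
    "(nat \<Rightarrow> 'a metric) \<Rightarrow> (nat \<Rightarrow> 'a \<Rightarrow> 'a) \<Rightarrow> nat \<Rightarrow> 'a \<Rightarrow> real \<Rightarrow> 'a set" where
  "bowen_cball X T n x \<epsilon> = {y \<in> mspace (X 0). bowen_dist X T n x y \<le> \<epsilon>}"

definition potentials :: "(nat \<Rightarrow> 'a metric) \<Rightarrow> (nat \<Rightarrow> 'a \<Rightarrow> real) set" where
  "potentials X = {f. \<forall>k. continuous_map (mtopology_of (X k)) euclideanreal (f k)}"

definition birkhoff_sum ::
    "(nat \<Rightarrow> 'a \<Rightarrow> 'a) \<Rightarrow> (nat \<Rightarrow> 'a \<Rightarrow> real) \<Rightarrow> nat \<Rightarrow> 'a \<Rightarrow> real" where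
  "birkhoff_sum T f n x = (\<Sum>j<n. f j (orbit_map T j x))"

definition zero_potential :: "nat \<Rightarrow> 'a \<Rightarrow> real" where
  "zero_potential = (\<lambda>k x. 0)"

definition equicontinuous ::
    "(nat \<Rightarrow> 'a metric) \<Rightarrow> (nat \<Rightarrow> 'b metric) \<Rightarrow> (nat \<Rightarrow> 'a \<Rightarrow> 'b) \<Rightarrow> bool" where
  "equicontinuous X Y \<phi> \<longleftrightarrow>
     (\<forall>\<epsilon>>0. \<exists>\<delta>>0. \<forall>k. \<forall>x'\<in>mspace (X k). \<forall>x''\<in>mspace (X k).
        mdist (X k) x' x'' < \<delta> \<longrightarrow> mdist (Y k) (\<phi> k x') (\<phi> k x'') < \<epsilon>)"

abbreviation equicontinuous_potential ::
    "(nat \<Rightarrow> 'a metric) \<Rightarrow> (nat \<Rightarrow> 'a \<Rightarrow> real) \<Rightarrow> bool" where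
  "equicontinuous_potential X f \<equiv> equicontinuous X (\<lambda>k. euclidean_metric) f"


section \<open>Semiconjugacies\<close>

definition semiconjugacy ::
    "(nat \<Rightarrow> 'a metric) \<Rightarrow> (nat \<Rightarrow> 'a \<Rightarrow> 'a) \<Rightarrow> (nat \<Rightarrow> 'b metric) \<Rightarrow> (nat \<Rightarrow> 'b \<Rightarrow> 'b) \<Rightarrow>
     (nat \<Rightarrow> 'a \<Rightarrow> 'b) \<Rightarrow> bool" where
  "semiconjugacy X T Y R \<pi> \<longleftrightarrow>
     (\<forall>k. continuous_map (mtopology_of (X k)) (mtopology_of (Y k)) (\<pi> k) \<and>
          \<pi> k ` mspace (X k) = mspace (Y k) \<and>
          (\<forall>x\<in>mspace (X k). R k (\<pi> k x) = \<pi> (Suc k) (T k x)))"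

definition conjugacy ::
    "(nat \<Rightarrow> 'a metric) \<Rightarrow> (nat \<Rightarrow> 'a \<Rightarrow> 'a) \<Rightarrow> (nat \<Rightarrow> 'b metric) \<Rightarrow> (nat \<Rightarrow> 'b \<Rightarrow> 'b) \<Rightarrow>
     (nat \<Rightarrow> 'a \<Rightarrow> 'b) \<Rightarrow> bool" where
  "conjugacy X T Y R \<pi> \<longleftrightarrow>
     semiconjugacy X T Y R \<pi> \<and>
     (\<forall>k. homeomorphic_map (mtopology_of (X k)) (mtopology_of (Y k)) (\<pi> k))"

definition equisemiconjugacy ::
    "(nat \<Rightarrow> 'a metric) \<Rightarrow> (nat \<Rightarrow> 'a \<Rightarrow> 'a) \<Rightarrow> (nat \<Rightarrow> 'b metric) \<Rightarrow> (nat \<Rightarrow> 'b \<Rightarrow> 'b) \<Rightarrow>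
     (nat \<Rightarrow> 'a \<Rightarrow> 'b) \<Rightarrow> bool" where
  "equisemiconjugacy X T Y R \<pi> \<longleftrightarrow> semiconjugacy X T Y R \<pi> \<and> equicontinuous X Y \<pi>"

definition equiconjugacy ::
    "(nat \<Rightarrow> 'a metric) \<Rightarrow> (nat \<Rightarrow> 'a \<Rightarrow> 'a) \<Rightarrow> (nat \<Rightarrow> 'b metric) \<Rightarrow> (nat \<Rightarrow> 'b \<Rightarrow> 'b) \<Rightarrow>
     (nat \<Rightarrow> 'a \<Rightarrow> 'b) \<Rightarrow> bool" where
  "equiconjugacy X T Y R \<pi> \<longleftrightarrow>
     conjugacy X T Y R \<pi> \<and> equicontinuous X Y \<pi> \<and>
     equicontinuous Y X (\<lambda>k. inv_into (mspace (X k)) (\<pi> k))"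

definition pullback :: "(nat \<Rightarrow> 'a \<Rightarrow> 'b) \<Rightarrow> (nat \<Rightarrow> 'b \<Rightarrow> real) \<Rightarrow> nat \<Rightarrow> 'a \<Rightarrow> real" where
  "pullback \<pi> g = (\<lambda>k. g k \<circ> \<pi> k)"


section \<open>Bowen pressure\<close>

text \<open>
  A countable family of Bowen balls is given by an index set \<open>I \<subseteq> \<nat>\<close>, finite or infinite, together
  with orders \<open>n i\<close> and centres \<open>x i\<close>. Sums of weights are taken in \<open>[0,\<infinity>]\<close>, pressures in
  \<open>[-\<infinity>,\<infinity>]\<close> (so the infimum of the empty set of exponents is \<open>\<infinity>\<close>).
\<close>

definition weight_sum ::
    "(nat \<Rightarrow> 'a \<Rightarrow> 'a) \<Rightarrow> (nat \<Rightarrow> 'a \<Rightarrow> real) \<Rightarrow> real \<Rightarrow> nat set \<Rightarrow> (nat \<Rightarrow> nat) \<Rightarrow> (nat \<Rightarrow> 'a) \<Rightarrow> ennreal"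
  where
  "weight_sum T f s I n x =
     (\<Sum>\<^sub>\<infinity>i\<in>I. ennreal (exp (- real (n i) * s + birkhoff_sum T f (n i) (x i))))"

definition bowen_cover ::
    "(nat \<Rightarrow> 'a metric) \<Rightarrow> (nat \<Rightarrow> 'a \<Rightarrow> 'a) \<Rightarrow> nat \<Rightarrow> real \<Rightarrow> 'a set \<Rightarrow>
     nat set \<Rightarrow> (nat \<Rightarrow> nat) \<Rightarrow> (nat \<Rightarrow> 'a) \<Rightarrow> bool" where
  "bowen_cover X T N \<epsilon> Z I n x \<longleftrightarrow>
     (\<forall>i\<in>I. x i \<in> mspace (X 0) \<and> N \<le> n i) \<and>
     Z \<subseteq> (\<Union>i\<in>I. bowen_ball X T (n i) (x i) \<epsilon>)"

definition bowen_outer_N ::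
    "(nat \<Rightarrow> 'a metric) \<Rightarrow> (nat \<Rightarrow> 'a \<Rightarrow> 'a) \<Rightarrow> (nat \<Rightarrow> 'a \<Rightarrow> real) \<Rightarrow> 'a set \<Rightarrow>
     real \<Rightarrow> real \<Rightarrow> nat \<Rightarrow> ennreal" where
  "bowen_outer_N X T f Z \<epsilon> s N =
     Inf {weight_sum T f s I n x | I n x. bowen_cover X T N \<epsilon> Z I n x}"

definition bowen_outer ::
    "(nat \<Rightarrow> 'a metric) \<Rightarrow> (nat \<Rightarrow> 'a \<Rightarrow> 'a) \<Rightarrow> (nat \<Rightarrow> 'a \<Rightarrow> real) \<Rightarrow> 'a set \<Rightarrow>
     real \<Rightarrow> real \<Rightarrow> ennreal" where
  "bowen_outer X T f Z \<epsilon> s = lim (bowen_outer_N X T f Z \<epsilon> s)"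

definition bowen_pressure_at ::
    "(nat \<Rightarrow> 'a metric) \<Rightarrow> (nat \<Rightarrow> 'a \<Rightarrow> 'a) \<Rightarrow> (nat \<Rightarrow> 'a \<Rightarrow> real) \<Rightarrow> 'a set \<Rightarrow> real \<Rightarrow> ereal" where
  "bowen_pressure_at X T f Z \<epsilon> = Inf (ereal ` {s. bowen_outer X T f Z \<epsilon> s = 0})"

definition bowen_pressure ::
    "(nat \<Rightarrow> 'a metric) \<Rightarrow> (nat \<Rightarrow> 'a \<Rightarrow> 'a) \<Rightarrow> (nat \<Rightarrow> 'a \<Rightarrow> real) \<Rightarrow> 'a set \<Rightarrow> ereal" where
  "bowen_pressure X T f Z = Lim (at_right 0) (bowen_pressure_at X T f Z)"

definition bowen_entropy ::
    "(nat \<Rightarrow> 'a metric) \<Rightarrow> (nat \<Rightarrow> 'a \<Rightarrow> 'a) \<Rightarrow> 'a set \<Rightarrow> ereal" where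
  "bowen_entropy X T Z = bowen_pressure X T zero_potential Z"


section \<open>Packing pressure\<close>

definition bowen_packing ::
    "(nat \<Rightarrow> 'a metric) \<Rightarrow> (nat \<Rightarrow> 'a \<Rightarrow> 'a) \<Rightarrow> nat \<Rightarrow> real \<Rightarrow> 'a set \<Rightarrow>
     nat set \<Rightarrow> (nat \<Rightarrow> nat) \<Rightarrow> (nat \<Rightarrow> 'a) \<Rightarrow> bool" where
  "bowen_packing X T N \<epsilon> Z I n x \<longleftrightarrow>
     (\<forall>i\<in>I. x i \<in> Z \<and> N \<le> n i) \<and>
     disjoint_family_on (\<lambda>i. bowen_cball X T (n i) (x i) \<epsilon>) I"

definition packing_pre_N ::
    "(nat \<Rightarrow> 'a metric) \<Rightarrow> (nat \<Rightarrow> 'a \<Rightarrow> 'a) \<Rightarrow> (nat \<Rightarrow> 'a \<Rightarrow> real) \<Rightarrow> 'a set \<Rightarrow>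
     real \<Rightarrow> real \<Rightarrow> nat \<Rightarrow> ennreal" where
  "packing_pre_N X T f Z \<epsilon> s N =
     Sup {weight_sum T f s I n x | I n x. bowen_packing X T N \<epsilon> Z I n x}"

definition packing_pre ::
    "(nat \<Rightarrow> 'a metric) \<Rightarrow> (nat \<Rightarrow> 'a \<Rightarrow> 'a) \<Rightarrow> (nat \<Rightarrow> 'a \<Rightarrow> real) \<Rightarrow> 'a set \<Rightarrow>
     real \<Rightarrow> real \<Rightarrow> ennreal" where
  "packing_pre X T f Z \<epsilon> s = lim (packing_pre_N X T f Z \<epsilon> s)"

definition packing_outer ::
    "(nat \<Rightarrow> 'a metric) \<Rightarrow> (nat \<Rightarrow> 'a \<Rightarrow> 'a) \<Rightarrow> (nat \<Rightarrow> 'a \<Rightarrow> real) \<Rightarrow> 'a set \<Rightarrow>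
     real \<Rightarrow> real \<Rightarrow> ennreal" where
  "packing_outer X T f Z \<epsilon> s =
     Inf {(\<Sum>i. packing_pre X T f (W i) \<epsilon> s) | W :: nat \<Rightarrow> 'a set.
            (\<forall>i. W i \<subseteq> mspace (X 0)) \<and> Z \<subseteq> (\<Union>i. W i)}"

definition packing_pressure_at ::
    "(nat \<Rightarrow> 'a metric) \<Rightarrow> (nat \<Rightarrow> 'a \<Rightarrow> 'a) \<Rightarrow> (nat \<Rightarrow> 'a \<Rightarrow> real) \<Rightarrow> 'a set \<Rightarrow> real \<Rightarrow> ereal" where
  "packing_pressure_at X T f Z \<epsilon> = Inf (ereal ` {s. packing_outer X T f Z \<epsilon> s = 0})"

definition packing_pressure ::
    "(nat \<Rightarrow> 'a metric) \<Rightarrow> (nat \<Rightarrow> 'a \<Rightarrow> 'a) \<Rightarrow> (nat \<Rightarrow> 'a \<Rightarrow> real) \<Rightarrow> 'a set \<Rightarrow> ereal" where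
  "packing_pressure X T f Z = Lim (at_right 0) (packing_pressure_at X T f Z)"

definition packing_entropy ::
    "(nat \<Rightarrow> 'a metric) \<Rightarrow> (nat \<Rightarrow> 'a \<Rightarrow> 'a) \<Rightarrow> 'a set \<Rightarrow> ereal" where
  "packing_entropy X T Z = packing_pressure X T zero_potential Z"


section \<open>The limits exist\<close>

text \<open>
  The constants \<open>lim\<close> and \<open>Lim\<close> are only meaningful for convergent arguments; the following facts
  show that all four limits above exist as monotone limits.
\<close>

lemma bowen_outer_N_mono: "N \<le> M \<Longrightarrow> bowen_outer_N X T f Z \<epsilon> s N \<le> bowen_outer_N X T f Z \<epsilon> s M"
  unfolding bowen_outer_N_def bowen_cover_def
  by (rule Inf_superset_mono) (blast intro: order_trans)

lemma packing_pre_N_antimono: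
  "N \<le> M \<Longrightarrow> packing_pre_N X T f Z \<epsilon> s M \<le> packing_pre_N X T f Z \<epsilon> s N"
  unfolding packing_pre_N_def bowen_packing_def
  by (rule Sup_subset_mono) (blast intro: order_trans)

lemma bowen_outer_tendsto: "bowen_outer_N X T f Z \<epsilon> s \<longlonglongrightarrow> bowen_outer X T f Z \<epsilon> s"
  unfolding bowen_outer_def
  using LIMSEQ_SUP[of "bowen_outer_N X T f Z \<epsilon> s"] bowen_outer_N_mono
  by (metis incseq_def limI)

lemma packing_pre_tendsto: "packing_pre_N X T f Z \<epsilon> s \<longlonglongrightarrow> packing_pre X T f Z \<epsilon> s"
  unfolding packing_pre_def
  using LIMSEQ_INF[of "packing_pre_N X T f Z \<epsilon> s"] packing_pre_N_antimono
  by (metis decseq_def limI)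

lemma bowen_outer_antimono_radius:
  assumes "\<epsilon> \<le> \<epsilon>'"
  shows "bowen_outer X T f Z \<epsilon>' s \<le> bowen_outer X T f Z \<epsilon> s"
proof -
  have "bowen_ball X T n x \<epsilon> \<subseteq> bowen_ball X T n x \<epsilon>'" for n x
    using assms by (auto simp: bowen_ball_def)
  then have "bowen_cover X T N \<epsilon> Z I n x \<Longrightarrow> bowen_cover X T N \<epsilon>' Z I n x" for N I n x
    unfolding bowen_cover_def by blast
  then have "bowen_outer_N X T f Z \<epsilon>' s N \<le> bowen_outer_N X T f Z \<epsilon> s N" for N
    unfolding bowen_outer_N_def by (intro Inf_superset_mono) blast
  then show ?thesis
    by (intro LIMSEQ_le[OF bowen_outer_tendsto bowen_outer_tendsto]) blast
qed

lemma packing_outer_antimono_radius: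
  assumes "\<epsilon> \<le> \<epsilon>'"
  shows "packing_outer X T f Z \<epsilon>' s \<le> packing_outer X T f Z \<epsilon> s"
proof -
  have "bowen_cball X T n x \<epsilon> \<subseteq> bowen_cball X T n x \<epsilon>'" for n x
    using assms by (auto simp: bowen_cball_def)
  then have "bowen_packing X T N \<epsilon>' Z I n x \<Longrightarrow> bowen_packing X T N \<epsilon> Z I n x" for N Z I n x
    unfolding bowen_packing_def disjoint_family_on_def by blast
  then have "packing_pre_N X T f Z \<epsilon>' s N \<le> packing_pre_N X T f Z \<epsilon> s N" for Z N
    unfolding packing_pre_N_def by (intro Sup_subset_mono) blast
  then have "packing_pre X T f Z \<epsilon>' s \<le> packing_pre X T f Z \<epsilon> s" for Z
    by (intro LIMSEQ_le[OF packing_pre_tendsto packing_pre_tendsto]) blast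
  then have *: "(\<Sum>i. packing_pre X T f (W i) \<epsilon>' s) \<le> (\<Sum>i. packing_pre X T f (W i) \<epsilon> s)" for W
    by (intro suminf_le) auto
  show ?thesis
    unfolding packing_outer_def by (rule Inf_mono) (use * in blast)
qed

lemma tendsto_at_right_0_antimono:
  fixes F :: "real \<Rightarrow> ereal"
  assumes "\<And>\<epsilon> \<epsilon>'. 0 < \<epsilon> \<Longrightarrow> \<epsilon> \<le> \<epsilon>' \<Longrightarrow> F \<epsilon>' \<le> F \<epsilon>"
  shows "(F \<longlongrightarrow> (SUP \<epsilon>\<in>{0<..}. F \<epsilon>)) (at_right 0)"
proof (rule order_tendstoI)
  fix a assume "a < (SUP \<epsilon>\<in>{0<..}. F \<epsilon>)"
  then obtain e where e: "0 < e" "a < F e"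
    by (auto simp: less_SUP_iff)
  have "\<forall>\<^sub>F x in at_right 0. x \<in> {0<..<e}"
    using e(1) by (rule eventually_at_right_real)
  then show "\<forall>\<^sub>F x in at_right 0. a < F x"
    by eventually_elim (use e assms in \<open>auto intro: less_le_trans\<close>)
next
  fix a assume a: "(SUP \<epsilon>\<in>{0<..}. F \<epsilon>) < a"
  have "\<forall>\<^sub>F x in at_right 0. x \<in> {0<..<1::real}"
    by (rule eventually_at_right_real) simp
  then show "\<forall>\<^sub>F x in at_right 0. F x < a"
    by eventually_elim (use a in \<open>auto intro: le_less_trans[OF SUP_upper]\<close>)
qed

lemma bowen_pressure_tendsto:
  "(bowen_pressure_at X T f Z \<longlongrightarrow> bowen_pressure X T f Z) (at_right 0)"
proof -
  have "bowen_pressure_at X T f Z \<epsilon>' \<le> bowen_pressure_at X T f Z \<epsilon>" if "\<epsilon> \<le> \<epsilon>'" for \<epsilon> \<epsilon>'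
    unfolding bowen_pressure_at_def
    using bowen_outer_antimono_radius[OF that, of X T f Z]
    by (intro Inf_superset_mono image_mono) (auto simp flip: le_zero_eq intro: order_trans)
  then have "(bowen_pressure_at X T f Z \<longlongrightarrow> (SUP \<epsilon>\<in>{0<..}. bowen_pressure_at X T f Z \<epsilon>)) (at_right 0)"
    by (intro tendsto_at_right_0_antimono)
  then show ?thesis
    unfolding bowen_pressure_def by (metis tendsto_Lim trivial_limit_at_right_real)
qed

lemma packing_pressure_tendsto:
  "(packing_pressure_at X T f Z \<longlongrightarrow> packing_pressure X T f Z) (at_right 0)"
proof -
  have "packing_pressure_at X T f Z \<epsilon>' \<le> packing_pressure_at X T f Z \<epsilon>" if "\<epsilon> \<le> \<epsilon>'" for \<epsilon> \<epsilon>'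
    unfolding packing_pressure_at_def
    using packing_outer_antimono_radius[OF that, of X T f Z]
    by (intro Inf_superset_mono image_mono) (auto simp flip: le_zero_eq intro: order_trans)
  then have "(packing_pressure_at X T f Z \<longlongrightarrow> (SUP \<epsilon>\<in>{0<..}. packing_pressure_at X T f Z \<epsilon>)) (at_right 0)"
    by (intro tendsto_at_right_0_antimono)
  then show ?thesis
    unfolding packing_pressure_def by (metis tendsto_Lim trivial_limit_at_right_real)
qed

end

theory Submission
  imports Defs
begin

text \<open>
  A semiconjugacy \<open>\<pi>\<close> intertwines the orbits, so the weights \<open>exp (- n s + S\<^sub>n f x)\<close> at \<open>x\<close> and at
  \<open>\<pi>\<^sub>0 x\<close> agree exactly. Equicontinuity gives, for each \<open>\<epsilon>\<close>, one radius \<open>\<delta>\<close> such that \<open>\<pi>\<^sub>0\<close> maps Bowen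
  balls of radius \<open>\<delta>\<close> into Bowen balls of radius \<open>\<epsilon>\<close>, for all orders \<open>n\<close> at once. Hence \<open>\<pi>\<^sub>0\<close> pushes
  covers forward, while packings of \<open>\<pi>\<^sub>0 W\<close> lift to packings of \<open>W\<close>; both give the inequality
  between the pressures at radii \<open>\<epsilon>\<close> and \<open>\<delta>\<close>. For an equiconjugacy, apply this to the inverse too.
\<close>

section \<open>Orbits, Bowen metrics and weights under a semiconjugacy\<close>

lemma orbit_map_in_mspace:
  assumes "nds X T" "x \<in> mspace (X 0)"
  shows "orbit_map T j x \<in> mspace (X j)"
proof (induction j)
  case (Suc j)
  then show ?case
    using assms(1) by (auto simp: nds_def dest!: spec[of _ j] continuous_map_funspace)
qed (use assms in simp)

lemma orbit_map_semiconjugacy: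
  assumes "nds X T" "semiconjugacy X T Y R \<pi>" "x \<in> mspace (X 0)"
  shows "orbit_map R j (\<pi> 0 x) = \<pi> j (orbit_map T j x)"
proof (induction j)
  case (Suc j)
  then show ?case
    using assms(2) orbit_map_in_mspace[OF assms(1,3), of j] by (simp add: semiconjugacy_def)
qed simp

text \<open>The set \<open>{0..n - 1}\<close> contains 0 even for \<open>n = 0\<close>, so the
  maximum is always over a nonempty finite set.\<close>

lemma bowen_dist_less_iff:
  "bowen_dist X T n x y < \<epsilon> \<longleftrightarrow>
     (\<forall>j\<le>n - 1. mdist (X j) (orbit_map T j x) (orbit_map T j y) < \<epsilon>)"
  unfolding bowen_dist_def by (subst Max_less_iff) auto

text \<open>The modulus \<delta> serves all k, so it applies at every time j to the two orbit
  points, which \<pi> carries to the orbits downstairs. This makes it uniform in n.\<close>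

lemma equisemiconjugacy_bowen_dist:
  assumes "nds X T" "equisemiconjugacy X T Y R \<pi>" "0 < \<epsilon>"
  obtains \<delta> where "0 < \<delta>"
    and "\<And>n x y. x \<in> mspace (X 0) \<Longrightarrow> y \<in> mspace (X 0) \<Longrightarrow> bowen_dist X T n x y < \<delta> \<Longrightarrow>
           bowen_dist Y R n (\<pi> 0 x) (\<pi> 0 y) < \<epsilon>"
proof -
  have semi: "semiconjugacy X T Y R \<pi>" and "equicontinuous X Y \<pi>"
    using assms(2) by (auto simp: equisemiconjugacy_def)
  then obtain \<delta> where \<delta>: "0 < \<delta>" "\<And>k x y. x \<in> mspace (X k) \<Longrightarrow> y \<in> mspace (X k) \<Longrightarrow>
      mdist (X k) x y < \<delta> \<Longrightarrow> mdist (Y k) (\<pi> k x) (\<pi> k y) < \<epsilon>"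
    using \<open>0 < \<epsilon>\<close> unfolding equicontinuous_def by metis
  show thesis
    using \<delta> that[of \<delta>] orbit_map_in_mspace[OF assms(1)] orbit_map_semiconjugacy[OF assms(1) semi]
    by (simp add: bowen_dist_less_iff)
qed

lemma semiconjugacy_mspace:
  "semiconjugacy X T Y R \<pi> \<Longrightarrow> x \<in> mspace (X k) \<Longrightarrow> \<pi> k x \<in> mspace (Y k)"
  by (auto simp: semiconjugacy_def)

text \<open>The sums agree term by term. Relating \<open>y\<close> to \<open>x\<close> only on
  \<open>I\<close> suits both uses: pushed centres \<open>\<pi> 0 \<circ> x\<close> for covers,
  chosen preimages for packings.\<close>

lemma weight_sum_semiconjugacy:
  assumes "nds X T" "semiconjugacy X T Y R \<pi>"
    and "\<And>k x. x \<in> mspace (X k) \<Longrightarrow> f k x = g k (\<pi> k x)"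
    and "\<And>i. i \<in> I \<Longrightarrow> x i \<in> mspace (X 0)"
    and "\<And>i. i \<in> I \<Longrightarrow> y i = \<pi> 0 (x i)"
  shows "weight_sum R g s I n y = weight_sum T f s I n x"
  unfolding weight_sum_def birkhoff_sum_def
  using assms orbit_map_semiconjugacy[OF assms(1,2)] orbit_map_in_mspace[OF assms(1)]
  by (intro infsum_cong) simp

section \<open>The pressure at one radius against its limit\<close>

lemma antimono_le_limit_at_right_0:
  fixes F :: "real \<Rightarrow> 'c :: linorder_topology"
  assumes "\<And>\<epsilon> \<epsilon>'. \<epsilon> \<le> \<epsilon>' \<Longrightarrow> F \<epsilon>' \<le> F \<epsilon>" and "(F \<longlongrightarrow> L) (at_right 0)" and "0 < \<epsilon>"
  shows "F \<epsilon> \<le> L"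
proof -
  have "\<forall>\<^sub>F e in at_right 0. e \<in> {0<..<\<epsilon>}"
    using \<open>0 < \<epsilon>\<close> by (rule eventually_at_right_real)
  then have "\<forall>\<^sub>F e in at_right 0. F \<epsilon> \<le> F e"
    by eventually_elim (simp add: assms(1))
  then show ?thesis
    by (intro tendsto_lowerbound[OF assms(2)]) simp_all
qed

text \<open>A larger radius lowers \<open>bowen_outer\<close>, so it vanishes for more exponents and
  the infimum drops.\<close>

lemma bowen_pressure_at_antimono:
  "\<epsilon> \<le> \<epsilon>' \<Longrightarrow> bowen_pressure_at X T f Z \<epsilon>' \<le> bowen_pressure_at X T f Z \<epsilon>"
  unfolding bowen_pressure_at_def
  using bowen_outer_antimono_radius[of \<epsilon> \<epsilon>' X T f Z]
  by (intro Inf_superset_mono image_mono) (auto simp flip: le_zero_eq intro: order_trans)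

lemma bowen_pressure_at_le_bowen_pressure:
  "0 < \<epsilon> \<Longrightarrow> bowen_pressure_at X T f Z \<epsilon> \<le> bowen_pressure X T f Z"
  by (rule antimono_le_limit_at_right_0[OF _ bowen_pressure_tendsto]) (rule bowen_pressure_at_antimono)

lemma packing_pressure_at_antimono:
  "\<epsilon> \<le> \<epsilon>' \<Longrightarrow> packing_pressure_at X T f Z \<epsilon>' \<le> packing_pressure_at X T f Z \<epsilon>"
  unfolding packing_pressure_at_def
  using packing_outer_antimono_radius[of \<epsilon> \<epsilon>' X T f Z]
  by (intro Inf_superset_mono image_mono) (auto simp flip: le_zero_eq intro: order_trans)

lemma packing_pressure_at_le_packing_pressure:
  "0 < \<epsilon> \<Longrightarrow> packing_pressure_at X T f Z \<epsilon> \<le> packing_pressure X T f Z"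
  by (rule antimono_le_limit_at_right_0[OF _ packing_pressure_tendsto]) (rule packing_pressure_at_antimono)

section \<open>The pressure inequalities for an equisemiconjugacy\<close>

text \<open>
  The hypothesis \<open>f k x = g k (\<pi> k x)\<close> on the carriers, instead of \<open>f = pullback \<pi> g\<close>, is symmetric
  under inverting \<open>\<pi>\<close> and also covers the zero potentials.
\<close>

lemma bowen_pressure_equisemiconjugacy_le:
  assumes nds: "nds X T" and equi: "equisemiconjugacy X T Y R \<pi>"
    and fg: "\<And>k x. x \<in> mspace (X k) \<Longrightarrow> f k x = g k (\<pi> k x)"
  shows "bowen_pressure Y R g (\<pi> 0 ` Z) \<le> bowen_pressure X T f Z"
proof (rule tendsto_upperbound[OF bowen_pressure_tendsto])
  have semi: "semiconjugacy X T Y R \<pi>"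
    using equi by (simp add: equisemiconjugacy_def)
  \<comment> \<open>The right-hand side is already the limit over radii, so \<delta> may depend on
    \<epsilon> arbitrarily.\<close>
  have "bowen_pressure_at Y R g (\<pi> 0 ` Z) \<epsilon> \<le> bowen_pressure X T f Z" if "0 < \<epsilon>" for \<epsilon>
  proof -
    obtain \<delta> where \<delta>: "0 < \<delta>"
      "\<And>n x y. x \<in> mspace (X 0) \<Longrightarrow> y \<in> mspace (X 0) \<Longrightarrow> bowen_dist X T n x y < \<delta> \<Longrightarrow>
         bowen_dist Y R n (\<pi> 0 x) (\<pi> 0 y) < \<epsilon>"
      using equisemiconjugacy_bowen_dist[OF nds equi \<open>0 < \<epsilon>\<close>] by metis
    have cover: "bowen_cover Y R N \<epsilon> (\<pi> 0 ` Z) I n (\<pi> 0 \<circ> x)"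
      if c: "bowen_cover X T N \<delta> Z I n x" for N I n x
      unfolding bowen_cover_def
    proof (intro conjI subsetI)
      fix w assume "w \<in> \<pi> 0 ` Z"
      then obtain z where z: "z \<in> Z" "w = \<pi> 0 z" by blast
      then obtain i where i: "i \<in> I" "z \<in> bowen_ball X T (n i) (x i) \<delta>"
        using c unfolding bowen_cover_def by blast
      \<comment> \<open>Lying in a Bowen ball places \<open>z\<close> in
        \<open>mspace (X 0)\<close>, as \<delta>(2) requires.\<close>
      then have "w \<in> bowen_ball Y R (n i) (\<pi> 0 (x i)) \<epsilon>"
        using c z \<delta>(2) semiconjugacy_mspace[OF semi] by (simp add: bowen_ball_def bowen_cover_def)
      then show "w \<in> (\<Union>i\<in>I. bowen_ball Y R (n i) ((\<pi> 0 \<circ> x) i) \<epsilon>)"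
        using i by auto
    qed (use c semiconjugacy_mspace[OF semi] in \<open>auto simp: bowen_cover_def\<close>)
    have weight: "weight_sum T f s I n x = weight_sum R g s I n (\<pi> 0 \<circ> x)"
      if "bowen_cover X T N \<delta> Z I n x" for N I n x s
      using that by (intro weight_sum_semiconjugacy[where f = f and g = g, OF nds semi fg, symmetric])
        (auto simp: bowen_cover_def)
    have "bowen_outer_N Y R g (\<pi> 0 ` Z) \<epsilon> s N \<le> bowen_outer_N X T f Z \<delta> s N" for s N
      unfolding bowen_outer_N_def
      by (rule Inf_superset_mono) (use cover weight in blast)
    then have "bowen_outer Y R g (\<pi> 0 ` Z) \<epsilon> s \<le> bowen_outer X T f Z \<delta> s" for s
      by (intro LIMSEQ_le[OF bowen_outer_tendsto bowen_outer_tendsto]) blast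
    then have "bowen_pressure_at Y R g (\<pi> 0 ` Z) \<epsilon> \<le> bowen_pressure_at X T f Z \<delta>"
      unfolding bowen_pressure_at_def
      by (intro Inf_superset_mono image_mono) (auto simp flip: le_zero_eq intro: order_trans)
    also have "\<dots> \<le> bowen_pressure X T f Z"
      using \<delta>(1) by (rule bowen_pressure_at_le_bowen_pressure)
    finally show ?thesis .
  qed
  then show "\<forall>\<^sub>F \<epsilon> in at_right 0. bowen_pressure_at Y R g (\<pi> 0 ` Z) \<epsilon> \<le> bowen_pressure X T f Z"
    by (auto intro: eventually_at_rightI[of 0 1])
qed simp

text \<open>Two directions meet here: packings, entering through a supremum, are lifted to X, while
  the countable covers in the outer infimum are pushed to Y.\<close>

lemma packing_pressure_equisemiconjugacy_le:
  assumes nds: "nds X T" and equi: "equisemiconjugacy X T Y R \<pi>"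
    and fg: "\<And>k x. x \<in> mspace (X k) \<Longrightarrow> f k x = g k (\<pi> k x)"
  shows "packing_pressure Y R g (\<pi> 0 ` Z) \<le> packing_pressure X T f Z"
proof (rule tendsto_upperbound[OF packing_pressure_tendsto])
  have semi: "semiconjugacy X T Y R \<pi>"
    using equi by (simp add: equisemiconjugacy_def)
  have "packing_pressure_at Y R g (\<pi> 0 ` Z) \<epsilon> \<le> packing_pressure X T f Z" if "0 < \<epsilon>" for \<epsilon>
  proof -
    obtain \<delta> where \<delta>: "0 < \<delta>"
      "\<And>n x y. x \<in> mspace (X 0) \<Longrightarrow> y \<in> mspace (X 0) \<Longrightarrow> bowen_dist X T n x y < \<delta> \<Longrightarrow>
         bowen_dist Y R n (\<pi> 0 x) (\<pi> 0 y) < \<epsilon>"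
      using equisemiconjugacy_bowen_dist[OF nds equi \<open>0 < \<epsilon>\<close>] by metis
    \<comment> \<open>Equicontinuity needs a strict bound, so closed balls get radius
      \<open>\<delta> / 2\<close>, inside the open \<delta>-balls.\<close>
    have ball: "\<pi> 0 z \<in> bowen_cball Y R n (\<pi> 0 x) \<epsilon>"
      if "x \<in> mspace (X 0)" "z \<in> bowen_cball X T n x (\<delta> / 2)" for n x z
      using that \<delta>(1) \<delta>(2)[of x z n] semiconjugacy_mspace[OF semi]
      by (simp add: bowen_cball_def)
    have lift: "\<exists>x. bowen_packing X T N (\<delta> / 2) W I n x \<and>
        weight_sum R g s I n y = weight_sum T f s I n x"
      if W: "W \<subseteq> mspace (X 0)" and p: "bowen_packing Y R N \<epsilon> (\<pi> 0 ` W) I n y" for W N I n y s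
    proof -
      \<comment> \<open>Packing centres must lie in the packed set, so the preimages are chosen in
        \<open>W\<close>.\<close>
      have "\<forall>i\<in>I. \<exists>x. x \<in> W \<and> y i = \<pi> 0 x"
        using p by (auto simp: bowen_packing_def)
      then obtain x where x: "\<And>i. i \<in> I \<Longrightarrow> x i \<in> W" "\<And>i. i \<in> I \<Longrightarrow> y i = \<pi> 0 (x i)"
        by metis
      have "disjoint_family_on (\<lambda>i. bowen_cball X T (n i) (x i) (\<delta> / 2)) I"
        unfolding disjoint_family_on_def
      proof (intro ballI impI equals0I)
        fix i j z
        assume ij: "i \<in> I" "j \<in> I" "i \<noteq> j"
          and z: "z \<in> bowen_cball X T (n i) (x i) (\<delta> / 2) \<inter> bowen_cball X T (n j) (x j) (\<delta> / 2)"
        \<comment> \<open>A common point upstairs would map to a common point of two disjoint balls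
          of the given packing.\<close>
        have "\<pi> 0 z \<in> bowen_cball Y R (n i) (y i) \<epsilon> \<inter> bowen_cball Y R (n j) (y j) \<epsilon>"
          using z ball[of "x i" z] ball[of "x j" z] x[OF ij(1)] x[OF ij(2)] W by auto
        then show False
          using p ij by (auto simp: bowen_packing_def disjoint_family_on_def)
      qed
      then have "bowen_packing X T N (\<delta> / 2) W I n x"
        using x p by (auto simp: bowen_packing_def)
      moreover have "weight_sum R g s I n y = weight_sum T f s I n x"
        using x W by (intro weight_sum_semiconjugacy[where f = f and g = g, OF nds semi fg]) auto
      ultimately show ?thesis by blast
    qed
    have "packing_pre_N Y R g (\<pi> 0 ` W) \<epsilon> s N \<le> packing_pre_N X T f W (\<delta> / 2) s N"
      if "W \<subseteq> mspace (X 0)" for W s N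
      unfolding packing_pre_N_def
      by (rule Sup_subset_mono) (use lift[OF that] in blast)
    then have "packing_pre Y R g (\<pi> 0 ` W) \<epsilon> s \<le> packing_pre X T f W (\<delta> / 2) s"
      if "W \<subseteq> mspace (X 0)" for W s
      using that by (intro LIMSEQ_le[OF packing_pre_tendsto packing_pre_tendsto]) blast
    then have sum_le: "(\<Sum>i. packing_pre Y R g (\<pi> 0 ` W i) \<epsilon> s) \<le>
        (\<Sum>i. packing_pre X T f (W i) (\<delta> / 2) s)"
      if "\<forall>i. W i \<subseteq> mspace (X 0)" for W :: "nat \<Rightarrow> 'a set" and s
      using that by (intro suminf_le) auto
    have "packing_outer Y R g (\<pi> 0 ` Z) \<epsilon> s \<le> packing_outer X T f Z (\<delta> / 2) s" for s
      unfolding packing_outer_def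
    proof (rule Inf_mono, clarify)
      fix W :: "nat \<Rightarrow> 'a set"
      assume W: "\<forall>i. W i \<subseteq> mspace (X 0)" "Z \<subseteq> (\<Union>i. W i)"
      \<comment> \<open>The images of the pieces cover the image of \<open>Z\<close>, with a sum
        that is no larger by \<open>sum_le\<close>.\<close>
      have "\<forall>i. \<pi> 0 ` W i \<subseteq> mspace (Y 0)"
        using W(1) by (auto intro!: semiconjugacy_mspace[OF semi])
      moreover have "\<pi> 0 ` Z \<subseteq> (\<Union>i. \<pi> 0 ` W i)"
        using image_mono[OF W(2), of "\<pi> 0"] by (simp only: image_UN)
      ultimately show "\<exists>a\<in>{(\<Sum>i. packing_pre Y R g (V i) \<epsilon> s) | V :: nat \<Rightarrow> _ set.
            (\<forall>i. V i \<subseteq> mspace (Y 0)) \<and> \<pi> 0 ` Z \<subseteq> (\<Union>i. V i)}.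
          a \<le> (\<Sum>i. packing_pre X T f (W i) (\<delta> / 2) s)"
        using sum_le[OF W(1)] by (intro bexI CollectI exI[of _ "\<lambda>i. \<pi> 0 ` W i"]) auto
    qed
    then have "packing_pressure_at Y R g (\<pi> 0 ` Z) \<epsilon> \<le> packing_pressure_at X T f Z (\<delta> / 2)"
      unfolding packing_pressure_at_def
      by (intro Inf_superset_mono image_mono) (auto simp flip: le_zero_eq intro: order_trans)
    also have "\<dots> \<le> packing_pressure X T f Z"
      using \<delta>(1) by (intro packing_pressure_at_le_packing_pressure) simp
    finally show ?thesis .
  qed
  then show "\<forall>\<^sub>F \<epsilon> in at_right 0. packing_pressure_at Y R g (\<pi> 0 ` Z) \<epsilon> \<le> packing_pressure X T f Z"
    by (auto intro: eventually_at_rightI[of 0 1])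
qed simp

section \<open>Inverting an equiconjugacy\<close>

lemma equiconjugacy_imp_equisemiconjugacy:
  "equiconjugacy X T Y R \<pi> \<Longrightarrow> equisemiconjugacy X T Y R \<pi>"
  by (simp add: equiconjugacy_def equisemiconjugacy_def conjugacy_def)

lemma equiconjugacy_inj_on:
  "equiconjugacy X T Y R \<pi> \<Longrightarrow> inj_on (\<pi> k) (mspace (X k))"
  by (metis conjugacy_def equiconjugacy_def homeomorphic_imp_injective_map topspace_mtopology_of)

text \<open>Equicontinuity of the inverse is part of the definition; continuity, surjectivity and
  intertwining remain to be checked.\<close>

lemma equiconjugacy_inverse:
  assumes "nds X T" and equi: "equiconjugacy X T Y R \<pi>"
  shows "equisemiconjugacy Y R X T (\<lambda>k. inv_into (mspace (X k)) (\<pi> k))"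
proof -
  have semi: "semiconjugacy X T Y R \<pi>"
    using equi by (simp add: equiconjugacy_def conjugacy_def)
  have surj: "\<pi> k ` mspace (X k) = mspace (Y k)" for k
    using semi by (simp add: semiconjugacy_def)
  note inj = equiconjugacy_inj_on[OF equi]
  have "continuous_map (mtopology_of (Y k)) (mtopology_of (X k)) (inv_into (mspace (X k)) (\<pi> k))" for k
  proof -
    have "homeomorphic_map (mtopology_of (X k)) (mtopology_of (Y k)) (\<pi> k)"
      using equi by (simp add: equiconjugacy_def conjugacy_def)
    \<comment> \<open>The topological inverse \<open>h\<close> may differ from
      \<open>inv_into\<close> off the carrier, but continuity depends only on values on it.\<close>
    then obtain h where h: "homeomorphic_maps (mtopology_of (X k)) (mtopology_of (Y k)) (\<pi> k) h"
      unfolding homeomorphic_map_maps by blast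
    then have "h y \<in> mspace (X k)" if "y \<in> mspace (Y k)" for y
      using that by (auto simp: homeomorphic_maps_def dest!: continuous_map_funspace)
    then have "h y = inv_into (mspace (X k)) (\<pi> k) y" if "y \<in> mspace (Y k)" for y
      using h that inj[of k]
      by (auto simp: homeomorphic_maps_def intro!: inv_into_f_eq[symmetric])
    then show ?thesis
      using h by (auto simp: homeomorphic_maps_def intro: continuous_map_eq)
  qed
  moreover have "inv_into (mspace (X k)) (\<pi> k) ` mspace (Y k) = mspace (X k)" for k
    unfolding surj[symmetric] using inj by (rule inv_into_image_cancel) simp
  moreover have "T k (inv_into (mspace (X k)) (\<pi> k) y) =
      inv_into (mspace (X (Suc k))) (\<pi> (Suc k)) (R k y)"
    if "y \<in> mspace (Y k)" for k y
  proof -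
    \<comment> \<open>Both sides equal \<open>T k x\<close> for the preimage \<open>x\<close> of
      \<open>y\<close>.\<close>
    from that obtain x where x: "x \<in> mspace (X k)" "y = \<pi> k x"
      by (auto simp flip: surj)
    have "continuous_map (mtopology_of (X k)) (mtopology_of (X (Suc k))) (T k)"
      using assms(1) by (simp add: nds_def)
    then have "T k x \<in> mspace (X (Suc k))"
      using x(1) by (auto dest!: continuous_map_funspace)
    moreover have "R k y = \<pi> (Suc k) (T k x)"
      using x semi by (simp add: semiconjugacy_def)
    ultimately show ?thesis
      using x inj by simp
  qed
  ultimately show ?thesis
    using equi by (simp add: equisemiconjugacy_def semiconjugacy_def equiconjugacy_def)
qed

lemma pressure_equiconjugacy_eq:
  assumes "nds X T" "nds Y R" and equi: "equiconjugacy X T Y R \<pi>"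
    and fg: "\<And>k x. x \<in> mspace (X k) \<Longrightarrow> f k x = g k (\<pi> k x)"
    and Z: "Z \<subseteq> mspace (X 0)"
  shows "bowen_pressure X T f Z = bowen_pressure Y R g (\<pi> 0 ` Z)"
    and "packing_pressure X T f Z = packing_pressure Y R g (\<pi> 0 ` Z)"
proof -
  note fwd = equiconjugacy_imp_equisemiconjugacy[OF equi]
  note bwd = equiconjugacy_inverse[OF assms(1) equi]
  have surj: "\<pi> k ` mspace (X k) = mspace (Y k)" for k
    using fwd by (simp add: equisemiconjugacy_def semiconjugacy_def)
  \<comment> \<open>This is the potential hypothesis for the inverse family, with f and g
    exchanged.\<close>
  have gf: "g k y = f k (inv_into (mspace (X k)) (\<pi> k) y)" if "y \<in> mspace (Y k)" for k y
    using that fg surj by (metis f_inv_into_f inv_into_into)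
  \<comment> \<open>By injectivity the backward inequality returns to \<open>Z\<close>
    itself.\<close>
  have Z_eq: "inv_into (mspace (X 0)) (\<pi> 0) ` \<pi> 0 ` Z = Z"
    using equiconjugacy_inj_on[OF equi] Z by (rule inv_into_image_cancel)
  have "\<pi> 0 ` Z \<subseteq> mspace (Y 0)"
    using image_mono[OF Z, of "\<pi> 0"] by (simp only: surj)
  then show "bowen_pressure X T f Z = bowen_pressure Y R g (\<pi> 0 ` Z)"
    using bowen_pressure_equisemiconjugacy_le[where f = f and g = g, OF assms(1) fwd fg, of Z]
      bowen_pressure_equisemiconjugacy_le[where f = g and g = f, OF assms(2) bwd gf, of "\<pi> 0 ` Z"] Z_eq
    by (intro antisym) simp_all
  show "packing_pressure X T f Z = packing_pressure Y R g (\<pi> 0 ` Z)"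
    using packing_pressure_equisemiconjugacy_le[where f = f and g = g, OF assms(1) fwd fg, of Z]
      packing_pressure_equisemiconjugacy_le[where f = g and g = f, OF assms(2) bwd gf, of "\<pi> 0 ` Z"] Z_eq
    by (intro antisym) simp_all
qed

theorem theorem4p1:
  fixes X :: "nat \<Rightarrow> 'a metric" and T :: "nat \<Rightarrow> 'a \<Rightarrow> 'a"
    and Y :: "nat \<Rightarrow> 'b metric" and R :: "nat \<Rightarrow> 'b \<Rightarrow> 'b"
    and g :: "nat \<Rightarrow> 'b \<Rightarrow> real" and Z :: "'a set"
  assumes "nds X T" and "nds Y R"
    and "g \<in> potentials Y" and "equicontinuous_potential Y g"
    and "Z \<subseteq> mspace (X 0)"
  shows "(\<forall>\<pi>. equisemiconjugacy X T Y R \<pi> \<longrightarrow>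
            bowen_pressure X T (pullback \<pi> g) Z \<ge> bowen_pressure Y R g (\<pi> 0 ` Z) \<and>
            packing_pressure X T (pullback \<pi> g) Z \<ge> packing_pressure Y R g (\<pi> 0 ` Z) \<and>
            bowen_entropy X T Z \<ge> bowen_entropy Y R (\<pi> 0 ` Z) \<and>
            packing_entropy X T Z \<ge> packing_entropy Y R (\<pi> 0 ` Z)) \<and>
         (\<forall>\<pi>. equiconjugacy X T Y R \<pi> \<longrightarrow>
            bowen_pressure X T (pullback \<pi> g) Z = bowen_pressure Y R g (\<pi> 0 ` Z) \<and>
            packing_pressure X T (pullback \<pi> g) Z = packing_pressure Y R g (\<pi> 0 ` Z) \<and>
            bowen_entropy X T Z = bowen_entropy Y R (\<pi> 0 ` Z) \<and>
            packing_entropy X T Z = packing_entropy Y R (\<pi> 0 ` Z))"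
proof (intro conjI[OF allI allI] impI)
  fix \<pi>
  assume equi: "equisemiconjugacy X T Y R \<pi>"
  \<comment> \<open>The potentials stay schematic: the pressure goals take
    \<open>pullback \<pi> g\<close> and \<open>g\<close>, the entropy goals the two zero
    potentials.\<close>
  note le = bowen_pressure_equisemiconjugacy_le[OF assms(1) equi]
    packing_pressure_equisemiconjugacy_le[OF assms(1) equi]
  show "bowen_pressure X T (pullback \<pi> g) Z \<ge> bowen_pressure Y R g (\<pi> 0 ` Z) \<and>
      packing_pressure X T (pullback \<pi> g) Z \<ge> packing_pressure Y R g (\<pi> 0 ` Z) \<and>
      bowen_entropy X T Z \<ge> bowen_entropy Y R (\<pi> 0 ` Z) \<and>
      packing_entropy X T Z \<ge> packing_entropy Y R (\<pi> 0 ` Z)"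
    unfolding bowen_entropy_def packing_entropy_def
    by (intro conjI le) (simp_all add: pullback_def zero_potential_def)
next
  fix \<pi>
  assume "equiconjugacy X T Y R \<pi>"
  note eq = pressure_equiconjugacy_eq[OF assms(1,2) this _ assms(5)]
  show "bowen_pressure X T (pullback \<pi> g) Z = bowen_pressure Y R g (\<pi> 0 ` Z) \<and>
      packing_pressure X T (pullback \<pi> g) Z = packing_pressure Y R g (\<pi> 0 ` Z) \<and>
      bowen_entropy X T Z = bowen_entropy Y R (\<pi> 0 ` Z) \<and>
      packing_entropy X T Z = packing_entropy Y R (\<pi> 0 ` Z)"
    unfolding bowen_entropy_def packing_entropy_def
    by (intro conjI eq) (simp_all add: pullback_def zero_potential_def)
qed

end
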